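(* In $\Sigma=\mathrm{PG}(n,2)$, let $S$ be a cap which meets a hyperplane $K_C$ of $\Sigma$ in a single point $c_0$. Choose a subspace $H_\infty\subset K_C$ of codimension $2$ in $\Sigma$ disjoint from $S$. Let $K_A,K_B$ be the other two hyperplanes containing $H_\infty$, $H_A=K_A\setminus H_\infty$, $H_B=K_B\setminus H_\infty$, $A=S\cap H_A$, $B=S\cap H_B$, $B'=H_B\setminus B$, and suppose $B'=c_0+A$. If $S$ is complete then $A$ and $B$ are not periodic. If $A$ (or $B$) is not periodic then either (i) $S$ is complete, or (ii) $|A|=|B|=2^{n-2}$ and $\Sigma=S\sqcup(S\oplus S)\sqcup\{e\}$ for some point $e\in H_\infty$, and the complete cap $T=S\sqcup\{e\}$ is periodic with $V(T)=\{e+c_0\}$.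
   Context: Points of $\mathrm{PG}(n,2)$ are the nonzero vectors of $\mathbb{F}_2^{n+1}$; three distinct points $x,y,z$ are collinear iff $x+y=z$. A cap is a set of points with no three collinear; it is complete if not properly contained in another cap. $X\oplus Y=\{x+y:x\in X,y\in Y,x\ne y\}$; $z+X=\{z+x:x\in X\}$. A set $X$ is periodic if some point $v$ satisfies $v+X=X$; such $v$ is a vertex, and $V(X)$ is the set of vertices of $X$.
   Formalization: Stated for n ≥ 2, and V(T) = {e+c_0} only for n ≥ 3 (for n = 2 only that e+c_0 lies in V(T)): for n = 1 one of A, B is empty, hence periodic, though S is complete; for n = 2 in case (ii) T is the complement of a line of the Fano plane, so V(T) has three points. *)

theory Defs
  imports "HOL-Analysis.Cartesian_Space" "HOL-Library.Z2"
begin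

text \<open>
  The projective space \<open>PG(n,2)\<close> is modelled on the type \<open>bit ^ 'n\<close> with \<open>CARD('n) = n + 1\<close>.
  Every set of points, projective subspaces included, is a set of vectors not containing \<open>0\<close>.
\<close>

definition pg_points :: "(bit ^ 'n) set" where
  "pg_points = {x. x \<noteq> 0}"

text \<open>The intended meaning is for three distinct points only.\<close>

definition pg_collinear :: "bit ^ 'n \<Rightarrow> bit ^ 'n \<Rightarrow> bit ^ 'n \<Rightarrow> bool" where
  "pg_collinear x y z \<longleftrightarrow> x + y = z"

text \<open>
  The projective dimension of \<open>W - {0}\<close> is \<open>vec.dim W - 1\<close>, so its codimension in \<open>PG(n,2)\<close> is
  \<open>n + 1 - vec.dim W\<close>.
\<close>

definition pg_subspace_codim :: "nat \<Rightarrow> (bit ^ 'n) set \<Rightarrow> bool" where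
  "pg_subspace_codim k U \<longleftrightarrow>
     (\<exists>W. vec.subspace W \<and> vec.dim W + k = CARD('n) \<and> U = W - {0})"

definition pg_hyperplane :: "(bit ^ 'n) set \<Rightarrow> bool" where
  "pg_hyperplane K \<longleftrightarrow> pg_subspace_codim 1 K"

definition cap :: "(bit ^ 'n) set \<Rightarrow> bool" where
  "cap X \<longleftrightarrow> X \<subseteq> pg_points \<and>
     (\<forall>x\<in>X. \<forall>y\<in>X. \<forall>z\<in>X. x \<noteq> y \<and> y \<noteq> z \<and> x \<noteq> z \<longrightarrow> \<not> pg_collinear x y z)"

definition complete_cap :: "(bit ^ 'n) set \<Rightarrow> bool" where
  "complete_cap X \<longleftrightarrow> cap X \<and> (\<nexists>Y. cap Y \<and> X \<subset> Y)"

definition pg_oplus :: "(bit ^ 'n) set \<Rightarrow> (bit ^ 'n) set \<Rightarrow> (bit ^ 'n) set" where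
  "pg_oplus X Y = {x + y | x y. x \<in> X \<and> y \<in> Y \<and> x \<noteq> y}"

definition translate :: "bit ^ 'n \<Rightarrow> (bit ^ 'n) set \<Rightarrow> (bit ^ 'n) set" where
  "translate z X = {z + x | x. x \<in> X}"

definition vertices :: "(bit ^ 'n) set \<Rightarrow> (bit ^ 'n) set" where
  "vertices X = {v \<in> pg_points. translate v X = X}"

definition periodic :: "(bit ^ 'n) set \<Rightarrow> bool" where
  "periodic X \<longleftrightarrow> (\<exists>v \<in> pg_points. translate v X = X)"

end

theory Submission imports Defs begin

text \<open>
  Put \<open>W = H\<^sub>\<infinity> \<union> {0}\<close> and fix \<open>a \<in> H\<^sub>A\<close>.  The ambient space is the union of the four cosets \<open>W\<close>,
  \<open>a + W\<close>, \<open>c\<^sub>0 + W\<close>, \<open>a + c\<^sub>0 + W\<close>, and \<open>S = {c\<^sub>0} \<union> A \<union> (c\<^sub>0 + A\<^sup>c)\<close>, where \<open>A\<^sup>c = H\<^sub>A - A\<close>.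
  All points of \<open>H\<^sub>A \<union> H\<^sub>B\<close> outside \<open>S\<close> lie in \<open>S \<oplus> S\<close>.  For \<open>0 \<noteq> w \<in> W\<close>, the point \<open>c\<^sub>0 + w\<close> lies
  outside \<open>S \<oplus> S\<close> iff \<open>w + A = A\<close>, and \<open>w\<close> lies outside \<open>S \<oplus> S\<close> iff \<open>w + A = A\<^sup>c\<close>.  If \<open>A\<close> is not
  periodic, there is at most one \<open>w\<close> of the second kind, the sum of two such being a period of \<open>A\<close>.
\<close>

section \<open>Vector arithmetic over the two-element field\<close>

lemma UNIV_bit: "UNIV = {0, 1 :: bit}"
  using bit_not_zero_iff by auto

instance bit :: finite
  by standard (simp add: UNIV_bit)

lemma vec_bit_add_self [simp]: "x + x = (0 :: bit ^ 'n)"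
  by (simp add: vec_eq_iff)

lemma vec_bit_add_self_left [simp]: "x + (x + y) = (y :: bit ^ 'n)"
  by (simp flip: add.assoc)

lemma vec_bit_add_self_right [simp]: "x + (y + x) = (y :: bit ^ 'n)"
  by (subst add.commute[of y]) simp

lemma vec_bit_add_self_both [simp]: "x + y + x = (y :: bit ^ 'n)"
  by (simp add: add.assoc)

lemma vec_bit_add_eq_0_iff [simp]: "x + y = (0 :: bit ^ 'n) \<longleftrightarrow> x = y"
  by (metis add.right_neutral vec_bit_add_self vec_bit_add_self_left)

lemma vec_bit_add_eq_iff: "x + y = z \<longleftrightarrow> y = x + (z :: bit ^ 'n)"
  by auto

lemma vec_bit_diff: "x - y = x + (y :: bit ^ 'n)"
  by (simp add: diff_eq_eq add.assoc)

section \<open>Translates\<close>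

lemma mem_translate_iff: "x \<in> translate v X \<longleftrightarrow> v + x \<in> X"
  unfolding translate_def by (auto intro: exI[of _ "v + x"])

text \<open>Closure under adding \<open>v\<close> suffices, because adding \<open>v\<close> twice is
  the identity.\<close>

lemma translate_eq_iff: "translate v X = X \<longleftrightarrow> (\<forall>x \<in> X. v + x \<in> X)"
proof
  assume "translate v X = X"
  then show "\<forall>x \<in> X. v + x \<in> X"
    by (metis mem_translate_iff)
next
  assume X: "\<forall>x \<in> X. v + x \<in> X"
  have "v + x \<in> X \<longleftrightarrow> x \<in> X" for x
    using bspec[OF X, of x] bspec[OF X, of "v + x"] by auto
  then show "translate v X = X"
    by (simp add: set_eq_iff mem_translate_iff)
qed

lemma card_translate: "card (translate v X) = card X"
proof -
  have "translate v X = (+) v ` X"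
    by (auto simp: translate_def)
  then show ?thesis
    by (simp add: card_image)
qed

lemma translate_empty_iff: "translate v X = {} \<longleftrightarrow> X = {}"
  by (auto simp: translate_def)

section \<open>Caps and completeness in terms of sums\<close>

lemma pg_oplus_subset: "pg_oplus X Y \<subseteq> pg_points"
  by (auto simp: pg_oplus_def pg_points_def)

text \<open>Distinctness from the third point is automatic: \<open>x + y = z\<close> and
  \<open>y = z\<close> give \<open>x = 0\<close>, which is not a point.\<close>

lemma cap_iff: "cap X \<longleftrightarrow> X \<subseteq> pg_points \<and> X \<inter> pg_oplus X X = {}"
proof -
  have "x \<noteq> y \<and> y \<noteq> z \<and> x \<noteq> z \<longleftrightarrow> x \<noteq> y"
    if "X \<subseteq> pg_points" "x \<in> X" "y \<in> X" "x + y = z" for x y z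
    using that by (auto simp: pg_points_def)
  then show ?thesis
    unfolding cap_def pg_collinear_def pg_oplus_def by blast
qed

text \<open>A collinear triple through \<open>z\<close> rearranges to \<open>x + w = z\<close> with
  \<open>x\<close>, \<open>w\<close> in \<open>X\<close>; the degenerate case \<open>x = w\<close>
  would give \<open>z = 0\<close>.\<close>

lemma cap_insert:
  assumes "cap X" "z \<in> pg_points" "z \<notin> pg_oplus X X"
  shows "cap (insert z X)"
proof -
  have no: "x + y \<noteq> z" if "x \<in> X" "y \<in> X" "x \<noteq> y" for x y
    using that assms(3) by (auto simp: pg_oplus_def)
  have "x + y \<noteq> w" if "x \<in> X" "y \<in> X" "w \<in> X" "x \<noteq> y" for x y w
    using that assms(1) by (auto simp: cap_iff pg_oplus_def)
  moreover have "z + x \<noteq> w" "x + z \<noteq> w" if "x \<in> X" "w \<in> X" for x w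
    using no[OF that] assms(2)
    by (auto simp: pg_points_def vec_bit_add_eq_iff add.commute)
  moreover have "0 \<notin> insert z X"
    using assms(1,2) by (auto simp: cap_iff pg_points_def)
  ultimately show ?thesis
    using no unfolding cap_def pg_collinear_def pg_points_def by auto
qed

text \<open>A point missed by \<open>X\<close> and its sums can be adjoined. Conversely, if nothing
  is missed, a new point of a larger cap \<open>Y\<close> would be a sum of two points of
  \<open>X\<close>, hence of \<open>Y\<close>.\<close>

lemma complete_cap_iff: "complete_cap X \<longleftrightarrow> cap X \<and> pg_points = X \<union> pg_oplus X X"
proof (cases "cap X")
  case True
  have X: "X \<union> pg_oplus X X \<subseteq> pg_points"
    using True pg_oplus_subset by (auto simp: cap_iff)
  show ?thesis
  proof
    assume "complete_cap X"
    then show "cap X \<and> pg_points = X \<union> pg_oplus X X"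
      using X cap_insert[OF True] unfolding complete_cap_def by blast
  next
    assume r: "cap X \<and> pg_points = X \<union> pg_oplus X X"
    have "\<not> X \<subset> Y" if Y: "cap Y" for Y
    proof
      assume XY: "X \<subset> Y"
      moreover have "Y \<subseteq> X \<union> pg_oplus X X"
        using Y r by (simp add: cap_iff)
      ultimately obtain z where "z \<in> Y" "z \<in> pg_oplus X X"
        by blast
      moreover have "pg_oplus X X \<subseteq> pg_oplus Y Y"
        using XY by (auto simp: pg_oplus_def)
      ultimately show False
        using Y by (auto simp: cap_iff)
    qed
    then show "complete_cap X"
      using True by (auto simp: complete_cap_def)
  qed
qed (simp add: complete_cap_def)

section \<open>Codimension-one steps between subspaces\<close>

text \<open>Dimension forces \<open>U\<close> to be the span of \<open>W\<close> and
  \<open>u\<close>; with 0 and 1 as the only scalars, this is the union of \<open>W\<close> and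
  \<open>u + W\<close>.\<close>

lemma subspace_bit_insert:
  fixes W U :: "(bit ^ 'n) set"
  assumes W: "vec.subspace W" and U: "vec.subspace U" and "W \<subseteq> U"
    and dim: "vec.dim U = vec.dim W + 1" and u: "u \<in> U" "u \<notin> W"
  shows "x \<in> U \<longleftrightarrow> x \<in> W \<or> u + x \<in> W"
proof -
  have span_W: "vec.span W = W"
    using W by (simp add: vec.span_eq_iff)
  have "vec.dim (vec.span (insert u W)) = vec.dim U"
    using u by (simp add: vec.dim_insert span_W dim)
  moreover have "vec.span (insert u W) \<subseteq> U"
    using assms by (intro vec.span_minimal) auto
  ultimately have "vec.span (insert u W) = U"
    using U by (intro vec.subspace_dim_equal) auto
  then have "x \<in> U \<longleftrightarrow> (\<exists>k. x - k *s u \<in> W)"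
    by (auto simp: vec.span_insert span_W)
  also have "\<dots> \<longleftrightarrow> x \<in> W \<or> u + x \<in> W"
  proof -
    have "(\<exists>k::bit. P k) \<longleftrightarrow> P 0 \<or> P 1" for P
      by (metis bit.exhaust)
    then show ?thesis
      by (simp add: vec_bit_diff add.commute)
  qed
  finally show ?thesis .
qed

section \<open>The four-coset model\<close>

text \<open>\<open>W\<close> is \<open>H_inf\<close> with 0 added, and \<open>c\<close> stands for
  \<open>c0\<close>. The three nonmemberships make the four cosets distinct. Lying in
  \<open>z + W\<close> is written \<open>z + x \<in> W\<close>, which turns coset questions into
  additive ones.\<close>

locale four_cosets =
  fixes W A :: "(bit ^ 'n) set" and a c :: "bit ^ 'n"
  assumes subspace: "vec.subspace W"
    and notin: "a \<notin> W" "c \<notin> W" "a + c \<notin> W"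
    and cover: "x \<in> W \<or> a + x \<in> W \<or> c + x \<in> W \<or> a + (c + x) \<in> W"
    and A_coset: "x \<in> A \<Longrightarrow> a + x \<in> W"
begin

definition HA where "HA = {x. a + x \<in> W}"
text \<open>This solves \<open>B' = c0 + A\<close> for \<open>B\<close>: the coset
  \<open>c + HA\<close> is \<open>H_B\<close>, and removing \<open>c + A\<close> from it leaves the
  translate of \<open>HA - A\<close>.\<close>

definition B where "B = translate c (HA - A)"
definition S where "S = insert c (A \<union> B)"

lemma zero_W: "0 \<in> W"
  using subspace by (rule vec.subspace_0)

lemma add_W: "w \<in> W \<Longrightarrow> w + x \<in> W \<longleftrightarrow> x \<in> W"
  using subspace by (metis vec.subspace_add vec_bit_add_self_left)

lemma add_W_left:
  assumes "w \<in> W"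
  shows "y + (w + x) \<in> W \<longleftrightarrow> y + x \<in> W" "w + x \<in> W \<longleftrightarrow> x \<in> W" "x + w \<in> W \<longleftrightarrow> x \<in> W"
  using add_W[OF assms, of "y + x"] add_W[OF assms, of x]
  by (simp_all add: add.left_commute add.commute)

lemma add_same_coset:
  assumes "z + x \<in> W" "z + y \<in> W"
  shows "x + y \<in> W"
proof -
  have "(z + x) + (z + y) = x + y"
    by (simp add: add.assoc add.left_commute[of x z])
  then show ?thesis
    using assms add_W by metis
qed

lemma mem_HA: "x \<in> HA \<longleftrightarrow> a + x \<in> W"
  by (simp add: HA_def)

lemma mem_B: "x \<in> B \<longleftrightarrow> a + (c + x) \<in> W \<and> c + x \<notin> A"
  by (auto simp: B_def mem_translate_iff HA_def)

lemma cosets_disjoint: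
  "x \<in> W \<Longrightarrow> a + x \<notin> W" "x \<in> W \<Longrightarrow> c + x \<notin> W" "x \<in> W \<Longrightarrow> a + (c + x) \<notin> W"
  "a + x \<in> W \<Longrightarrow> c + x \<notin> W" "a + x \<in> W \<Longrightarrow> a + (c + x) \<notin> W"
  "c + x \<in> W \<Longrightarrow> a + (c + x) \<notin> W"
  using notin add_W[of x a] add_W[of x c] add_W[of x "a + c"] 
    add_W[of "a + x" "a + c"] add_W[of "a + x" c] add_W[of "c + x" a]
  by (auto simp: add.commute add.left_commute)

lemma mem_S:
  "x \<in> W \<Longrightarrow> x \<notin> S"
  "c + x \<in> W \<Longrightarrow> x \<in> S \<longleftrightarrow> x = c"
  "a + x \<in> W \<Longrightarrow> x \<in> S \<longleftrightarrow> x \<in> A"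
  "a + (c + x) \<in> W \<Longrightarrow> x \<in> S \<longleftrightarrow> c + x \<notin> A"
  using cosets_disjoint[of x] cosets_disjoint[of c] notin A_coset[of x] zero_W
  by (auto simp: S_def mem_B)

lemma S_cases [consumes 1]:
  assumes "x \<in> S"
  obtains (c) "x = c" | (A) "x \<in> A" "a + x \<in> W" | (B) "a + (c + x) \<in> W" "c + x \<notin> A"
  using assms A_coset[of x] by (auto simp: S_def mem_B)

section \<open>Points covered by sums\<close>

text \<open>The point \<open>c\<close> does the covering: \<open>x = c + (c + x)\<close>, and
  \<open>c + x\<close> lies in \<open>B\<close> because \<open>x\<close> is missing from
  \<open>A\<close>.\<close>

lemma oplus_S_HA:
  assumes "a + x \<in> W" "x \<notin> A"
  shows "x \<in> pg_oplus S S"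
proof -
  have "c + x \<in> S" "c \<in> S" "c + x \<noteq> c"
    using assms zero_W notin by (auto simp: S_def mem_B)
  then show ?thesis
    unfolding pg_oplus_def by (force intro: exI[of _ c] exI[of _ "c + x"])
qed

lemma oplus_S_HB:
  assumes "a + (c + x) \<in> W" "c + x \<in> A"
  shows "x \<in> pg_oplus S S"
proof -
  have "c + x \<in> S" "c \<in> S" "c + x \<noteq> c"
    using assms zero_W notin by (auto simp: S_def add.commute)
  then show ?thesis
    unfolding pg_oplus_def by (force intro: exI[of _ c] exI[of _ "c + x"])
qed

text \<open>Since \<open>S\<close> misses \<open>W\<close>, a sum in \<open>c + W\<close> must pair
  some \<open>x\<close> in \<open>A\<close> with \<open>c + (w + x)\<close> in \<open>B\<close>. The
  latter means \<open>w + x \<notin> A\<close>, so such a pair exists exactly when \<open>w\<close>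
  moves a point of \<open>A\<close> out of \<open>A\<close>.\<close>

lemma oplus_S_HC:
  assumes w: "w \<in> W"
  shows "c + w \<in> pg_oplus S S \<longleftrightarrow> translate w A \<noteq> A"
proof
  assume "c + w \<in> pg_oplus S S"
  then obtain s t where st: "s \<in> S" "t \<in> S" "c + w = s + t"
    by (auto simp: pg_oplus_def)
  then have t: "t = c + (w + s)"
    by (metis add.assoc add.commute vec_bit_add_self_left)
  show "translate w A \<noteq> A"
    using st(1)
  proof (cases rule: S_cases)
    case c
    then have "t = w"
      using t by simp
    then show ?thesis
      using st(2) w mem_S(1) by simp
  next
    case A
    then have "w + s \<notin> A"
      using st(2) t w by (simp add: mem_S(4) add_W_left)
    then show ?thesis
      using A by (auto simp: mem_translate_iff)
  next
    case B
    then have "t \<in> A"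
      using st(2) t w by (simp add: mem_S(3) add_W_left add.left_commute[of c])
    then have "w + (c + s) \<in> A"
      by (simp add: t add.left_commute)
    then show ?thesis
      using B by (auto simp: mem_translate_iff)
  qed
next
  assume "translate w A \<noteq> A"
  then obtain x where x: "x \<in> A" "w + x \<notin> A"
    by (auto simp: translate_eq_iff)
  then have "x \<in> S" "c + (w + x) \<in> S"
    using w A_coset by (auto simp: S_def mem_B add_W_left)
  moreover have "x \<noteq> c + (w + x)"
  proof
    assume "x = c + (w + x)"
    then have "w = c"
      by (metis vec_bit_add_self_right add.assoc)
    then show False
      using w notin by simp
  qed
  moreover have "c + w = x + (c + (w + x))"
    by (simp add: add.left_commute add.commute)
  ultimately show "c + w \<in> pg_oplus S S"
    unfolding pg_oplus_def by blast
qed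

text \<open>Distinct points of \<open>S\<close> with sum in \<open>W\<close> lie both in
  \<open>A\<close> or both in \<open>B\<close>. After shifting \<open>B\<close> back by
  \<open>c\<close>, this is a pair \<open>x\<close>, \<open>w + x\<close> in \<open>HA\<close> on
  the same side of \<open>A\<close>; none exists exactly when \<open>w\<close> exchanges
  \<open>A\<close> with its complement.\<close>

lemma oplus_S_W:
  assumes w: "w \<in> W" "w \<noteq> 0"
  shows "w \<in> pg_oplus S S \<longleftrightarrow> translate w A \<noteq> HA - A"
proof
  assume "w \<in> pg_oplus S S"
  then obtain s t where st: "s \<in> S" "t \<in> S" "w = s + t"
    by (auto simp: pg_oplus_def)
  then have t: "t = w + s"
    by (metis add.commute vec_bit_add_self_left)
  show "translate w A \<noteq> HA - A"
    using st(1)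
  proof (cases rule: S_cases)
    case c
    then have "c + t \<in> W"
      using t w by (simp add: add_W_left zero_W)
    then have "t = c"
      using st(2) by (simp add: mem_S(2))
    then show ?thesis
      using c st(3) w by simp
  next
    case A
    then have "w + s \<in> A"
      using st(2) t w by (simp add: mem_S(3) add_W_left)
    then have "s \<in> translate w A" "s \<notin> HA - A"
      using A by (simp_all add: mem_translate_iff)
    then show ?thesis
      by blast
  next
    case B
    then have "c + (w + s) \<notin> A"
      using st(2) t w by (simp add: mem_S(4) add_W_left add.left_commute[of c])
    then have "c + s \<notin> translate w A" "c + s \<in> HA - A"
      using B by (simp_all add: mem_translate_iff mem_HA add.left_commute)
    then show ?thesis
      by blast
  qed
next
  assume "translate w A \<noteq> HA - A"
  then consider x where "x \<in> HA" "x \<in> A" "w + x \<in> A" | x where "x \<in> HA" "x \<notin> A" "w + x \<notin> A"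
    using A_coset w by (auto simp: mem_translate_iff set_eq_iff mem_HA) (metis add_W_left(1))+
  then show "w \<in> pg_oplus S S"
  proof cases
    case (1 x)
    then have "x \<in> S" "w + x \<in> S" "x \<noteq> w + x" "w = x + (w + x)"
      using w by (auto simp: S_def add.left_commute)
    then show ?thesis
      unfolding pg_oplus_def by blast
  next
    case (2 x)
    then have "c + x \<in> S" "c + (w + x) \<in> S" "c + x \<noteq> c + (w + x)" "w = c + x + (c + (w + x))"
      using w by (auto simp: S_def mem_B mem_HA add_W_left add.left_commute add.commute)
    then show ?thesis
      unfolding pg_oplus_def by blast
  qed
qed

section \<open>Periods of \<open>A\<close> and \<open>B\<close>\<close>

text \<open>Translation by \<open>w\<close> preserves \<open>HA\<close>, so it fixes
  \<open>A\<close> iff it fixes the complement \<open>HA - A\<close>, of which \<open>B\<close> is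
  the shift by \<open>c\<close>.\<close>

lemma translate_B_eq_iff:
  assumes "w \<in> W"
  shows "translate w B = B \<longleftrightarrow> translate w A = A"
proof -
  have "translate w B = B \<longleftrightarrow> (\<forall>x. w + x \<in> B \<longleftrightarrow> x \<in> B)"
    by (auto simp: mem_translate_iff set_eq_iff)
  also have "\<dots> \<longleftrightarrow> (\<forall>x. w + (c + x) \<in> B \<longleftrightarrow> c + x \<in> B)"
    by (metis vec_bit_add_self_left)
  also have "\<dots> \<longleftrightarrow> (\<forall>x. a + x \<in> W \<longrightarrow> (w + x \<in> A \<longleftrightarrow> x \<in> A))"
    using assms by (auto simp: mem_B add_W_left add.left_commute)
  \<comment> \<open>Outside \<open>HA\<close> neither \<open>x\<close> nor \<open>w + x\<close>
    belongs to \<open>A\<close>.\<close>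
  also have "\<dots> \<longleftrightarrow> (\<forall>x. w + x \<in> A \<longleftrightarrow> x \<in> A)"
    using assms A_coset by (metis add_W_left(1))
  also have "\<dots> \<longleftrightarrow> translate w A = A"
    by (auto simp: mem_translate_iff set_eq_iff)
  finally show ?thesis .
qed

text \<open>A period of a nonempty subset of a coset is the sum of two of its points, hence in
  \<open>W\<close>. The empty set has every point as a period, and \<open>W \<noteq> {0}\<close>
  supplies one in \<open>W\<close>.\<close>

lemma periodic_coset:
  assumes X: "\<And>x. x \<in> X \<Longrightarrow> z + x \<in> W" and W: "W \<noteq> {0}"
  shows "periodic X \<longleftrightarrow> (\<exists>w \<in> W - {0}. translate w X = X)"
proof
  assume "periodic X"
  then obtain v where v: "v \<noteq> 0" "translate v X = X"
    by (auto simp: periodic_def pg_points_def)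
  show "\<exists>w \<in> W - {0}. translate w X = X"
  proof (cases "X = {}")
    case True
    then show ?thesis
      using W zero_W by (auto simp: translate_empty_iff)
  next
    case False
    then obtain x where x: "x \<in> X"
      by blast
    then have "v + x \<in> X"
      using v(2) by (simp add: translate_eq_iff)
    then have "v \<in> W"
      using add_same_coset[of z x "v + x"] x X by simp
    then show ?thesis
      using v by blast
  qed
qed (auto simp: periodic_def pg_points_def)

lemma periodic_A: "W \<noteq> {0} \<Longrightarrow> periodic A \<longleftrightarrow> (\<exists>w \<in> W - {0}. translate w A = A)"
  using A_coset by (rule periodic_coset)

lemma periodic_B:
  assumes "W \<noteq> {0}"
  shows "periodic B \<longleftrightarrow> periodic A"
proof -
  have "periodic B \<longleftrightarrow> (\<exists>w \<in> W - {0}. translate w B = B)"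
    using assms by (intro periodic_coset[where z = "a + c"]) (auto simp: mem_B add.assoc)
  then show ?thesis
    using assms by (simp add: periodic_A translate_B_eq_iff)
qed

section \<open>Completeness and uncovered points\<close>

text \<open>A period \<open>w\<close> of \<open>A\<close> would leave the point \<open>c + w\<close>
  uncovered.\<close>

lemma complete_imp_not_periodic:
  assumes "complete_cap S" "W \<noteq> {0}"
  shows "\<not> periodic A"
proof
  assume "periodic A"
  then obtain w where w: "w \<in> W" "w \<noteq> 0" "translate w A = A"
    using assms by (auto simp: periodic_A)
  have "c + w \<notin> S"
    using w by (simp add: mem_S(2))
  moreover have "c + w \<noteq> 0"
    using w(1) notin by auto
  ultimately show False
    using assms(1) w oplus_S_HC[of w] by (auto simp: complete_cap_iff pg_points_def)
qed

lemma uncovered_point: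
  assumes cap: "cap S" and W: "W \<noteq> {0}" and np: "\<not> periodic A" and nc: "\<not> complete_cap S"
  obtains e where "e \<in> W - {0}" "translate e A = HA - A" 
    "pg_points = S \<union> pg_oplus S S \<union> {e}"
proof -
  have S: "S \<union> pg_oplus S S \<subseteq> pg_points"
    using cap pg_oplus_subset by (auto simp: cap_iff)
  have W_if: "x \<in> W - {0} \<and> translate x A = HA - A"
    if x: "x \<in> pg_points" "x \<notin> S \<union> pg_oplus S S" for x
  proof -
    consider "x \<in> W" | "c + x \<in> W" | "a + x \<in> W" | "a + (c + x) \<in> W"
      using cover by blast
    then show ?thesis
    proof cases
      case 1
      then show ?thesis
        using x oplus_S_W[of x] by (auto simp: pg_points_def)
    next
      case 2
      \<comment> \<open>An uncovered point here would yield the period \<open>c + x\<close>, nonzero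
        because \<open>c\<close> itself is in \<open>S\<close>.\<close>
      then have "translate (c + x) A = A" "c + x \<noteq> 0"
        using x oplus_S_HC[of "c + x"] by (auto simp: S_def)
      then show ?thesis
        using 2 np W by (auto simp: periodic_A)
    next
      case 3
      then show ?thesis
        using x oplus_S_HA[of x] by (auto simp: mem_S(3))
    next
      case 4
      then show ?thesis
        using x oplus_S_HB[of x] by (auto simp: mem_S(4))
    qed
  qed
  obtain e where e: "e \<in> pg_points" "e \<notin> S \<union> pg_oplus S S"
    using S nc cap by (auto simp: complete_cap_iff)
  have "f = e" if f: "f \<in> pg_points" "f \<notin> S \<union> pg_oplus S S" for f
  proof (rule ccontr)
    assume "f \<noteq> e"
    \<comment> \<open>Both \<open>e\<close> and \<open>f\<close> exchange \<open>A\<close> with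
      \<open>HA - A\<close>, so applying one after the other restores \<open>A\<close>.\<close>
    have "x \<in> translate (e + f) A \<longleftrightarrow> x \<in> A" for x
    proof -
      have "x \<in> translate (e + f) A \<longleftrightarrow> f + x \<in> translate e A"
        by (simp add: mem_translate_iff add.assoc)
      also have "\<dots> \<longleftrightarrow> x \<in> HA \<and> f + x \<notin> A"
        using W_if[OF e] W_if[OF f] by (auto simp: mem_HA add_W_left)
      also have "\<dots> \<longleftrightarrow> x \<in> HA \<and> x \<notin> translate f A"
        by (simp add: mem_translate_iff)
      also have "\<dots> \<longleftrightarrow> x \<in> A"
        using W_if[OF f] A_coset by (auto simp: mem_HA)
      finally show ?thesis .
    qed
    then have "translate (e + f) A = A"
      by blast
    moreover have "e + f \<in> W - {0}"
      using W_if[OF e] W_if[OF f] \<open>f \<noteq> e\<close> by (auto simp: add_W)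
    ultimately show False
      using np W periodic_A by blast
  qed
  then have "pg_points = S \<union> pg_oplus S S \<union> {e}"
    using S e by blast
  with e W_if[OF e] show thesis
    by (intro that) auto
qed

section \<open>Cardinalities\<close>

lemma card_W: "4 * card W = 2 ^ CARD('n)"
proof -
  define f where "f = (\<lambda>z. translate z W)"
  have card: "card (f z) = card W" for z
    by (simp add: f_def card_translate)
  \<comment> \<open>Bracketing the four cosets as two pairs leaves only three disjointness facts to
    check.\<close>
  have UN: "UNIV = (f 0 \<union> f a) \<union> (f c \<union> f (a + c))"
    using cover by (simp add: f_def mem_translate_iff add.assoc set_eq_iff)
  have "(f 0 \<union> f a) \<inter> (f c \<union> f (a + c)) = {}" "f 0 \<inter> f a = {}" "f c \<inter> f (a + c) = {}"
    using cosets_disjoint by (auto simp: f_def mem_translate_iff add.assoc)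
  then have "CARD(bit ^ 'n) = 4 * card W"
    unfolding UN by (simp add: card_Un_disjoint card)
  then show ?thesis
    by (simp add: UNIV_bit numeral_2_eq_2)
qed

text \<open>Translation by \<open>e\<close> matches \<open>A\<close> with its complement in
  \<open>HA\<close>, a coset of size \<open>card W\<close>; \<open>B\<close> is a translate of that
  complement.\<close>

lemma card_halves:
  assumes "translate e A = HA - A"
  shows "2 * card A = card W" "2 * card B = card W"
proof -
  have "HA = translate a W"
    by (auto simp: mem_HA mem_translate_iff)
  then have HA: "card HA = card W"
    by (simp add: card_translate)
  have "A \<subseteq> HA"
    using A_coset by (auto simp: mem_HA)
  then have "card (HA - A) = card HA - card A" "card A \<le> card HA"
    by (simp_all add: card_Diff_subset card_mono)
  moreover have "card (HA - A) = card A"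
    using card_translate[of e A] assms by simp
  ultimately show "2 * card A = card W" "2 * card B = card W"
    using HA by (simp_all add: B_def card_translate)
qed

section \<open>Vertices of the enlarged cap\<close>

text \<open>Adding \<open>e + c\<close> swaps \<open>e\<close> with \<open>c\<close> and
  \<open>A\<close> with \<open>B\<close>. Conversely, a vertex \<open>v\<close> sends
  \<open>e\<close> into \<open>S\<close>. If \<open>v + e\<close> is not \<open>c\<close>, then
  \<open>v\<close> lies in the coset of \<open>A\<close> or of \<open>B\<close> and carries that
  whole set into \<open>W\<close>, where \<open>e\<close> is the only available image. That set then
  has at most one point, but its size is half of \<open>card W\<close>.\<close>

lemma vertices_insert:
  assumes e: "e \<in> W - {0}" "translate e A = HA - A"
  shows "e + c \<in> vertices (insert e S)"
    and "2 < card W \<Longrightarrow> vertices (insert e S) = {e + c}"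
proof -
  have mem_e: "e + x \<in> A \<longleftrightarrow> x \<in> HA - A" for x
    using e(2) mem_translate_iff[of x e A] by simp
  have "e + c + x \<in> insert e S" if "x \<in> insert e S" for x
  proof (cases "x = e")
    case True
    then show ?thesis
      by (simp add: S_def)
  next
    case False
    with that have "x \<in> S"
      by simp
    then show ?thesis
    proof (cases rule: S_cases)
      case c
      then show ?thesis
        by (simp add: add.assoc)
    next
      case A
      have "c + (e + (c + x)) = e + x"
        by (simp add: add.left_commute[of e c])
      with A have "e + (c + x) \<in> B"
        using e(1) mem_e[of x] by (auto simp: mem_B add_W_left)
      then show ?thesis
        by (simp add: S_def add.assoc)
    next
      case B
      then have "e + (c + x) \<in> A"
        by (simp add: mem_e mem_HA)
      then show ?thesis
        by (simp add: S_def add.assoc)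
    qed
  qed
  then have "translate (e + c) (insert e S) = insert e S"
    by (simp add: translate_eq_iff)
  moreover have "e + c \<noteq> 0"
    using e notin by auto
  ultimately show v: "e + c \<in> vertices (insert e S)"
    by (simp add: vertices_def pg_points_def)
  assume W: "2 < card W"
  show "vertices (insert e S) = {e + c}"
  proof -
    have "v = e + c" if "v \<in> vertices (insert e S)" for v
    proof -
      have v: "v \<noteq> 0" "x \<in> insert e S \<Longrightarrow> v + x \<in> insert e S" for x
        using that by (auto simp: vertices_def pg_points_def translate_eq_iff)
      have ve: "v + e \<in> S"
        using v(1) v(2)[of e] by auto
      \<comment> \<open>\<open>v\<close> permutes the cosets of \<open>W\<close>, and \<open>e\<close> is the only point of \<open>S \<union> {e}\<close> in \<open>W\<close>.\<close>
      have unique: "x = y" if "x \<in> S" "y \<in> S" "v + x \<in> W" "v + y \<in> W" for x y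
      proof -
        have "v + x = e" "v + y = e"
          using v(2)[of x] v(2)[of y] that mem_S(1) by auto
        then show ?thesis
          by (metis vec_bit_add_self_left)
      qed
      have small: "2 * card X \<noteq> card W" if "X \<subseteq> S" "\<And>x. x \<in> X \<Longrightarrow> v + x \<in> W" for X
      proof -
        have "card X \<le> 1"
          using that unique by (simp add: card_le_Suc0_iff_eq subset_iff)
        then show ?thesis
          using W by simp
      qed
      show ?thesis
        using ve
      proof (cases rule: S_cases)
        case c
        then show ?thesis
          by (metis add.commute vec_bit_add_self_left)
      next
        case A
        then have "v + x \<in> W" if "x \<in> A" for x
          using add_same_coset[of a "v + e" x] A_coset[OF that] e(1)
          by (simp add: add.assoc add_W_left)
        then show ?thesis
          using small[of A] card_halves[OF e(2)] by (auto simp: S_def)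
      next
        case B
        then have "v + x \<in> W" if "x \<in> B" for x
          using add_same_coset[of "a + c" "v + e" x] that e(1)
          by (simp add: mem_B add.assoc add_W_left)
        then show ?thesis
          using small[of B] card_halves[OF e(2)] by (auto simp: S_def)
      qed
    qed
    then show ?thesis
      using v by blast
  qed
qed

end

section \<open>From the projective hypotheses to the four cosets\<close>

theorem theorem3p7:
  fixes n :: nat
    and S K_A K_B K_C H_inf H_A H_B A B B' :: "(bit ^ 'n) set"
    and c0 :: "bit ^ 'n"
  assumes dim: "CARD('n) = n + 1" "2 \<le> n"
    and cap_S: "cap S"
    and K_C: "pg_hyperplane K_C" "S \<inter> K_C = {c0}"
    and H_inf: "pg_subspace_codim 2 H_inf" "H_inf \<subseteq> K_C" "H_inf \<inter> S = {}"
    and K_A: "pg_hyperplane K_A" "H_inf \<subseteq> K_A"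
    and K_B: "pg_hyperplane K_B" "H_inf \<subseteq> K_B"
    and distinct: "K_A \<noteq> K_B" "K_A \<noteq> K_C" "K_B \<noteq> K_C"
    and H_A: "H_A = K_A - H_inf"
    and H_B: "H_B = K_B - H_inf"
    and A: "A = S \<inter> H_A"
    and B: "B = S \<inter> H_B"
    and B': "B' = H_B - B" "B' = translate c0 A"
  shows "(complete_cap S \<longrightarrow> \<not> periodic A \<and> \<not> periodic B) \<and>
    (\<not> periodic A \<or> \<not> periodic B \<longrightarrow>
       complete_cap S \<or>
       (card A = 2 ^ (n - 2) \<and> card B = 2 ^ (n - 2) \<and>
        (\<exists>e \<in> H_inf.
           pg_points = S \<union> pg_oplus S S \<union> {e} \<and>
           S \<inter> pg_oplus S S = {} \<and> e \<notin> S \<and> e \<notin> pg_oplus S S \<and>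
           complete_cap (S \<union> {e}) \<and>
           periodic (S \<union> {e}) \<and>
           e + c0 \<in> vertices (S \<union> {e}) \<and>
           (3 \<le> n \<longrightarrow> vertices (S \<union> {e}) = {e + c0}))))"
proof -
  obtain W where W: "vec.subspace W" "vec.dim W + 2 = CARD('n)" "H_inf = W - {0}"
    using H_inf(1) by (auto simp: pg_subspace_codim_def)
  have hyperplane: "\<exists>U. vec.subspace U \<and> vec.dim U = n \<and> W \<subseteq> U \<and> K = U - {0} \<and>
      (\<forall>u x. u \<in> U - W \<longrightarrow> (x \<in> U \<longleftrightarrow> x \<in> W \<or> u + x \<in> W))"
    if K: "pg_hyperplane K" "H_inf \<subseteq> K" for K
  proof -
    obtain U where U: "vec.subspace U" "vec.dim U + 1 = CARD('n)" "K = U - {0}"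
      using K(1) by (auto simp: pg_hyperplane_def pg_subspace_codim_def)
    moreover have "W \<subseteq> U"
      using K(2) W(3) U(3) vec.subspace_0[OF U(1)] by blast
    ultimately show ?thesis
      using subspace_bit_insert[OF W(1) U(1)] W(2) dim(1) by (intro exI[of _ U]) auto
  qed
  obtain UA where UA: "vec.subspace UA" "vec.dim UA = n" "W \<subseteq> UA" "K_A = UA - {0}"
      "\<And>u x. u \<in> UA - W \<Longrightarrow> x \<in> UA \<longleftrightarrow> x \<in> W \<or> u + x \<in> W"
    using hyperplane[OF K_A] by blast
  obtain UB where UB: "vec.subspace UB" "vec.dim UB = n" "W \<subseteq> UB" "K_B = UB - {0}"
      "\<And>u x. u \<in> UB - W \<Longrightarrow> x \<in> UB \<longleftrightarrow> x \<in> W \<or> u + x \<in> W"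
    using hyperplane[OF K_B] by blast
  obtain UC where UC: "vec.subspace UC" "vec.dim UC = n" "W \<subseteq> UC" "K_C = UC - {0}"
      "\<And>u x. u \<in> UC - W \<Longrightarrow> x \<in> UC \<longleftrightarrow> x \<in> W \<or> u + x \<in> W"
    using hyperplane[OF K_C(1) H_inf(2)] by blast
  have W0: "0 \<in> W"
    using W(1) by (rule vec.subspace_0)
  have c0: "c0 \<in> S" "c0 \<in> UC - W"
    using K_C(2) H_inf(3) UC(4) W(3) by auto
  have "\<not> UA \<subseteq> W"
    using UA(2,3) W(2) dim(1) by (auto dest: subset_antisym)
  then obtain a where a: "a \<in> UA - W"
    by blast
  have "\<not> UB \<subseteq> W"
    using UB(2,3) W(2) dim(1) by (auto dest: subset_antisym)
  then obtain b where b: "b \<in> UB - W"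
    by blast
  \<comment> \<open>A common vector outside \<open>W\<close> would make both subspaces the union of
    \<open>W\<close> and the same coset, so the hyperplanes would coincide.\<close>
  have a_UC: "a \<notin> UC"
    using UA(5)[OF a] UC(5)[of a] a distinct(2) UA(4) UC(4) by blast
  have b_UC: "b \<notin> UC"
    using UB(5)[OF b] UC(5)[of b] b distinct(3) UB(4) UC(4) by blast
  have b_UA: "b \<notin> UA"
    using UB(5)[OF b] UA(5)[of b] b distinct(1) UB(4) UA(4) by blast
  have c0_UA: "c0 \<notin> UA"
    using UA(5)[OF a, of c0] UC(5)[OF c0(2), of a] a_UC c0(2) by (auto simp: add.commute)
  \<comment> \<open>Two codimension-one steps: the whole space is \<open>UA\<close> with
    \<open>c0 + UA\<close>, and \<open>UA\<close> is \<open>W\<close> with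
    \<open>a + W\<close>.\<close>
  have cover: "x \<in> W \<or> a + x \<in> W \<or> c0 + x \<in> W \<or> a + (c0 + x) \<in> W" for x
  proof -
    have "vec.dim (UNIV :: (bit ^ 'n) set) = vec.dim UA + 1"
      using UA(2) dim(1) by (simp only: vec_dim_card)
    then show ?thesis
      using subspace_bit_insert[OF UA(1) vec.subspace_UNIV, of c0 x] c0_UA UA(5)[OF a] by auto
  qed
  interpret four_cosets W A a c0
  proof
    show "a + c0 \<notin> W"
      using UA(5)[OF a] c0_UA by blast
    show "a + x \<in> W" if "x \<in> A" for x
      using that UA(5)[OF a, of x] A H_A UA(4) W(3) by auto
  qed (use W(1) a c0 cover in auto)
  have H_A_eq: "H_A = HA"
    using H_A UA(4) W(3) UA(5)[OF a] cosets_disjoint(1) W0 notin by (auto simp: HA_def)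
  \<comment> \<open>As \<open>b\<close> avoids \<open>W\<close>, \<open>UA\<close> and
    \<open>UC\<close>, only the fourth coset is left for it; hence \<open>H_B\<close> is that
    coset.\<close>
  have "a + (c0 + b) \<in> W"
    using cover[of b] b b_UA b_UC UA(5)[OF a] UC(5)[OF c0(2)] by blast
  then have "b + x \<in> W \<longleftrightarrow> a + (c0 + x) \<in> W" for x
    using add_W[of "a + (c0 + b)" "b + x"] by (simp add: ac_simps)
  then have H_B_eq: "x \<in> H_B \<longleftrightarrow> a + (c0 + x) \<in> W" for x
    using H_B UB(4) W(3) UB(5)[OF b, of x] cosets_disjoint(3)[of x] W0 notin by auto
  \<comment> \<open>Because \<open>B\<close> lies in \<open>H_B\<close>, the two equations for
    \<open>B'\<close> determine it as the complement of \<open>c0 + A\<close> in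
    \<open>H_B\<close>.\<close>
  have B_eq: "B = four_cosets.B W A a c0"
    unfolding set_eq_iff mem_B using B B' H_B_eq by (auto simp: mem_translate_iff set_eq_iff)
  have S_eq: "S = four_cosets.S W A a c0"
  proof -
    have "x \<in> S \<longleftrightarrow> x \<in> four_cosets.S W A a c0" for x
    proof -
      have "x \<notin> S" if "x \<in> W"
        using that H_inf(3) W(3) cap_S by (auto simp: cap_def pg_points_def)
      moreover have "x \<in> S \<longleftrightarrow> x = c0" if "c0 + x \<in> W"
      proof -
        have "x \<in> K_C"
          using that UC(4) UC(5)[OF c0(2)] c0(2) by auto
        then show ?thesis
          using K_C(2) by blast
      qed
      moreover have "x \<in> S \<longleftrightarrow> x \<in> A" if "a + x \<in> W"
        using that A H_A_eq by (auto simp: mem_HA)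
      moreover have "x \<in> S \<longleftrightarrow> c0 + x \<notin> A" if "a + (c0 + x) \<in> W"
        using that B B_eq H_B_eq mem_B by blast
      ultimately show ?thesis
        using cover[of x] mem_S[of x] by blast
    qed
    then show ?thesis
      by blast
  qed
  \<comment> \<open>This resolves the truncated difference \<open>n - 2\<close>, so that cancelling
    4 in \<open>2 ^ (n + 1)\<close> leaves twice the required size of \<open>A\<close> and
    \<open>B\<close>.\<close>
  obtain k where "n = 2 + k"
    using dim(2) le_Suc_ex by blast
  then have cardW: "card W = 2 * 2 ^ (n - 2)"
    using card_W dim(1) by simp
  then have "card W \<noteq> 1"
    by presburger
  then have Wnt: "W \<noteq> {0}"
    by auto
  \<comment> \<open>This reduces the disjunction in the second claim to \<open>A\<close>
    alone.\<close>
  have per: "periodic B \<longleftrightarrow> periodic A"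
    using periodic_B[OF Wnt] B_eq by simp
  have "card A = 2 ^ (n - 2) \<and> card B = 2 ^ (n - 2) \<and>
        (\<exists>e \<in> H_inf.
           pg_points = S \<union> pg_oplus S S \<union> {e} \<and>
           S \<inter> pg_oplus S S = {} \<and> e \<notin> S \<and> e \<notin> pg_oplus S S \<and>
           complete_cap (S \<union> {e}) \<and>
           periodic (S \<union> {e}) \<and>
           e + c0 \<in> vertices (S \<union> {e}) \<and>
           (3 \<le> n \<longrightarrow> vertices (S \<union> {e}) = {e + c0}))"
    if np: "\<not> periodic A" "\<not> complete_cap S"
  proof -
    obtain e where e: "e \<in> W - {0}" "translate e A = HA - A"
        "pg_points = S \<union> pg_oplus S S \<union> {e}"
      using uncovered_point[folded S_eq, OF cap_S Wnt np] by blast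
    have eS: "e \<notin> S" "e \<notin> pg_oplus S S"
      using e mem_S(1) oplus_S_W by (auto simp: S_eq)
    have "cap (insert e S)"
      using e eS cap_S by (intro cap_insert) (auto simp: pg_points_def)
    moreover have "pg_points = insert e S \<union> pg_oplus (insert e S) (insert e S)"
    proof
      have "pg_oplus S S \<subseteq> pg_oplus (insert e S) (insert e S)"
        by (auto simp: pg_oplus_def)
      then show "pg_points \<subseteq> insert e S \<union> pg_oplus (insert e S) (insert e S)"
        using e(3) by auto
      show "insert e S \<union> pg_oplus (insert e S) (insert e S) \<subseteq> pg_points"
        using e(3) pg_oplus_subset by blast
    qed
    ultimately have "complete_cap (insert e S)"
      by (simp add: complete_cap_iff)
    moreover have v: "e + c0 \<in> vertices (insert e S)"
      using vertices_insert(1)[OF e(1,2)] S_eq by simp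
    \<comment> \<open>For \<open>n = 2\<close> the enlarged cap is the complement of a line in the
      Fano plane, and all three points of that line are vertices. From \<open>n = 3\<close> on,
      \<open>W\<close> has at least four elements.\<close>
    moreover have "vertices (insert e S) = {e + c0}" if "3 \<le> n"
    proof -
      have "2 ^ 1 \<le> (2 :: nat) ^ (n - 2)"
        using that by (intro power_increasing) auto
      then show ?thesis
        using vertices_insert(2)[OF e(1,2)] S_eq cardW by simp
    qed
    moreover have "periodic (insert e S)"
      using v by (auto simp: periodic_def vertices_def)
    ultimately show ?thesis
      using card_halves[OF e(2)] cardW B_eq e eS W(3) cap_S by (auto simp: cap_iff)
  qed
  then show ?thesis
    using complete_imp_not_periodic Wnt per S_eq by auto
qed

end
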